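(* Let $\Gamma$ be a discrete subgroup of $SL(2,\mathbb{R})$ and let $k,n$ be integers with $n\ge0$ and $k>n$. For a polynomial $F(z,X)=\sum_{r=0}^nf_r(z)X^r$ with coefficients $f_r$ holomorphic on $\mathcal{H}$, set \[\mathcal{U}_n(F(z,X))=\sum_{\ell=0}^n(-1)^n(n-\ell)!\,D^\ell(\widehat{v}_n)\,f_\ell,\] where $\widehat{v}_n(z)={}^t(z^n,\ldots,z,1)$ and $D=d/dz$. Then this formula determines an isomorphism of complex vector spaces \[\mathcal{U}_n:QP^n_{k+n}(\Gamma)\xrightarrow{\ \approx\ }\widehat{M}^{n+1}_k(\Gamma,\rho_n).\]
   Context: $\mathcal{H}$ is the upper half plane with the action of $SL(2,\mathbb{R})$ by linear fractional transformations; for $\gamma=\begin{pmatrix}a&b\\c&d\end{pmatrix}$ write $\mathfrak{J}(\gamma,z)=cz+d$ and $\mathfrak{K}(\gamma,z)=c/(cz+d)$. For a representation $\rho:\Gamma\to GL(N,\mathbb{C})$ and an integer $k$, $\widehat{M}^N_k(\Gamma,\rho)$ is the space of holomorphic $G:\mathcal{H}\to\mathbb{C}^N$ with $\mathfrak{J}(\gamma,z)^{-k}G(\gamma z)=\rho(\gamma)G(z)$ for all $\gamma\in\Gamma$ (no growth condition at cusps). $\rho_n:SL(2,\mathbb{R})\to GL(n+1,\mathbb{R})$ is the $n$-th symmetric tensor representation, defined by $\rho_n(\gamma)\binom{z_1}{z_2}^n=\left(\gamma\binom{z_1}{z_2}\right)^n$ with $\binom{z_1}{z_2}^n:={}^t(z_1^n,z_1^{n-1}z_2,\ldots,z_2^n)$.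 For integers $\lambda$ and $m\ge0$, $QP^m_\lambda(\Gamma)$ is the space of polynomials $\Phi(z,X)=\sum_{r=0}^m\phi_r(z)X^r$ with $\phi_r$ holomorphic on $\mathcal{H}$ such that $\mathfrak{J}(\gamma,z)^{-\lambda}\Phi\bigl(\gamma z,\mathfrak{J}(\gamma,z)^2(X-\mathfrak{K}(\gamma,z))\bigr)=\Phi(z,X)$ for all $\gamma\in\Gamma$. *)

theory Defs
  imports "HOL-Complex_Analysis.Complex_Analysis" "Jordan_Normal_Form.VS_Connect"
begin

hide_const (open) Finite_Cartesian_Product.vec Finite_Cartesian_Product.mat

no_notation Formal_Power_Series.fps_nth (infixl "$" 75)
no_notation Matrix.vec_index (infixl "$" 100)

text \<open>The group is modelled on the type of real 2-by-2 matrices of HOL-Analysis, which carries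
  the topology used to say that a subgroup is discrete.  Vectors and matrices whose size depends
  on a natural number are those of Jordan_Normal_Form; their indices start at 0.\<close>

definition uhp :: "complex set" where
  "uhp = {z. Im z > 0}"

definition SL2R :: "(real^2^2) monoid" where
  "SL2R = \<lparr>carrier = {\<gamma>. Determinants.det \<gamma> = 1}, mult = (**), one = Finite_Cartesian_Product.mat 1\<rparr>"

definition discrete_subgroup_SL2R :: "(real^2^2) set \<Rightarrow> bool" where
  "discrete_subgroup_SL2R \<Gamma> \<longleftrightarrow> subgroup \<Gamma> SL2R \<and> discrete \<Gamma>"

definition act :: "real^2^2 \<Rightarrow> complex \<Rightarrow> complex" where
  "act \<gamma> = moebius (of_real (\<gamma>$1$1)) (of_real (\<gamma>$1$2)) (of_real (\<gamma>$2$1)) (of_real (\<gamma>$2$2))"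

definition JJ :: "real^2^2 \<Rightarrow> complex \<Rightarrow> complex" where
  "JJ \<gamma> z = of_real (\<gamma>$2$1) * z + of_real (\<gamma>$2$2)"

definition KK :: "real^2^2 \<Rightarrow> complex \<Rightarrow> complex" where
  "KK \<gamma> z = of_real (\<gamma>$2$1) / JJ \<gamma> z"


subsection \<open>Symmetric tensor representations\<close>

definition sym_vec :: "nat \<Rightarrow> 'a::comm_semiring_1 \<Rightarrow> 'a \<Rightarrow> 'a vec" where
  "sym_vec n z1 z2 = vec (n + 1) (\<lambda>i. z1 ^ (n - i) * z2 ^ i)"

definition is_sym_rep_matrix :: "nat \<Rightarrow> real^2^2 \<Rightarrow> real mat \<Rightarrow> bool" where
  "is_sym_rep_matrix n \<gamma> A \<longleftrightarrow> A \<in> carrier_mat (n + 1) (n + 1) \<and>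
     (\<forall>z1 z2. A *\<^sub>v sym_vec n z1 z2 =
        sym_vec n (\<gamma>$1$1 * z1 + \<gamma>$1$2 * z2) (\<gamma>$2$1 * z1 + \<gamma>$2$2 * z2))"

definition sym_rep :: "nat \<Rightarrow> real^2^2 \<Rightarrow> real mat" where
  "sym_rep n \<gamma> = (THE A. is_sym_rep_matrix n \<gamma> A)"

lemma homogeneous_mult_linear:
  fixes c :: "nat \<Rightarrow> real" and p q :: real
  shows "\<exists>c'. \<forall>x y. (p * x + q * y) * (\<Sum>j\<le>m. c j * (x ^ (m - j) * y ^ j)) =
           (\<Sum>j\<le>Suc m. c' j * (x ^ (Suc m - j) * y ^ j))"
proof -
  define c' where "c' j = (if j \<le> m then p * c j else 0) + (if j = 0 then 0 else q * c (j - 1))" for j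
  have "(p * x + q * y) * (\<Sum>j\<le>m. c j * (x ^ (m - j) * y ^ j)) =
           (\<Sum>j\<le>Suc m. c' j * (x ^ (Suc m - j) * y ^ j))" for x y
  proof -
    have 1: "(\<Sum>j\<le>Suc m. (if j \<le> m then p * c j else 0) * (x ^ (Suc m - j) * y ^ j)) =
        p * x * (\<Sum>j\<le>m. c j * (x ^ (m - j) * y ^ j))"
      by (auto simp: sum_distrib_left Suc_diff_le mult_ac intro!: sum.cong)
    have 2: "(\<Sum>j\<le>Suc m. (if j = 0 then 0 else q * c (j - 1)) * (x ^ (Suc m - j) * y ^ j)) =
        q * y * (\<Sum>j\<le>m. c j * (x ^ (m - j) * y ^ j))"
      by (subst sum.atMost_Suc_shift) (simp add: sum_distrib_left mult_ac)
    show ?thesis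
      unfolding c'_def distrib_right sum.distrib 1 2 ..
  qed
  then show ?thesis by blast
qed

lemma homogeneous_linear_power:
  fixes a b c d :: real
  shows "\<exists>e. \<forall>x y. (a * x + b * y) ^ k * (c * x + d * y) ^ l =
           (\<Sum>j\<le>k+l. e j * (x ^ (k + l - j) * y ^ j))"
proof (induction k)
  case 0
  show ?case
  proof (induction l)
    case 0
    show ?case by (rule exI[of _ "\<lambda>_. 1"]) simp
  next
    case (Suc l)
    then obtain e where "\<forall>x y. (c * x + d * y) ^ l = (\<Sum>j\<le>l. e j * (x ^ (l - j) * y ^ j))"
      by (simp only: power_0 mult_1 add_0) blast
    with homogeneous_mult_linear[where p = c and q = d and m = l and c = e] show ?case by (simp del: sum.atMost_Suc)
  qed
next
  case (Suc k)
  then obtain e where "\<forall>x y. (a * x + b * y) ^ k * (c * x + d * y) ^ l =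
      (\<Sum>j\<le>k+l. e j * (x ^ (k + l - j) * y ^ j))" by blast
  with homogeneous_mult_linear[where p = a and q = b and m = "k + l" and c = e] show ?case
    by (simp add: mult.assoc del: sum.atMost_Suc)
qed

lemma ex1_sym_rep_matrix: "\<exists>!A. is_sym_rep_matrix n \<gamma> A"
proof (rule ex_ex1I)
  define P where "P i e \<longleftrightarrow> (\<forall>x y.
      (\<gamma>$1$1 * x + \<gamma>$1$2 * y) ^ (n - i) * (\<gamma>$2$1 * x + \<gamma>$2$2 * y) ^ i =
      (\<Sum>j\<le>n. e j * (x ^ (n - j) * y ^ j)))" for i and e :: "nat \<Rightarrow> real"
  have ex: "\<exists>e. P i e" if "i \<le> n" for i
    using homogeneous_linear_power[where k = "n - i" and l = i and a = "\<gamma>$1$1" and b = "\<gamma>$1$2"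
        and c = "\<gamma>$2$1" and d = "\<gamma>$2$2"] that
    unfolding P_def by simp
  define E where "E i = (SOME e. P i e)" for i
  have E: "(\<gamma>$1$1 * x + \<gamma>$1$2 * y) ^ (n - i) * (\<gamma>$2$1 * x + \<gamma>$2$2 * y) ^ i =
      (\<Sum>j\<le>n. E i j * (x ^ (n - j) * y ^ j))" if "i \<le> n" for i x y
    using someI_ex[OF ex[OF that]] unfolding P_def E_def by blast
  have "is_sym_rep_matrix n \<gamma> (mat (n + 1) (n + 1) (\<lambda>(i, j). E i j))"
    unfolding is_sym_rep_matrix_def sym_vec_def
    by (auto intro!: eq_vecI sum.cong simp: scalar_prod_def E atLeast0LessThan lessThan_Suc_atMost
        simp del: sum.atMost_Suc)
  then show "\<exists>A. is_sym_rep_matrix n \<gamma> A" ..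
next
  fix A B
  assume A: "is_sym_rep_matrix n \<gamma> A" and B: "is_sym_rep_matrix n \<gamma> B"
  note carr = A[unfolded is_sym_rep_matrix_def, THEN conjunct1]
    B[unfolded is_sym_rep_matrix_def, THEN conjunct1]
  show "A = B"
  proof (rule eq_matI)
    fix i j assume "i < dim_row B" "j < dim_col B"
    then have ij: "i \<le> n" "j \<le> n" using carr by auto
    have row: "vec_index (M *\<^sub>v sym_vec n 1 t) i = (\<Sum>j\<le>n. M $$ (i, j) * t ^ j)"
      if "M \<in> carrier_mat (n + 1) (n + 1)" for M and t :: real
      using that ij
      by (auto simp: sym_vec_def scalar_prod_def atLeast0LessThan lessThan_Suc_atMost)
    have "(A *\<^sub>v sym_vec n 1 t) = (B *\<^sub>v sym_vec n 1 t)" for t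
      using A B by (simp add: is_sym_rep_matrix_def)
    then have "\<forall>t. (\<Sum>j\<le>n. A $$ (i, j) * t ^ j) = (\<Sum>j\<le>n. B $$ (i, j) * t ^ j)"
      using row[OF carr(1)] row[OF carr(2)] by metis
    then show "A $$ (i, j) = B $$ (i, j)"
      using ij(2) unfolding polyfun_eq_coeffs by blast
  qed (use carr in auto)
qed

lemma is_sym_rep_matrix_sym_rep: "is_sym_rep_matrix n \<gamma> (sym_rep n \<gamma>)"
  unfolding sym_rep_def by (rule theI'[OF ex1_sym_rep_matrix])


subsection \<open>Spaces of functions on the upper half plane\<close>

text \<open>Functions on a set \<open>S\<close> are represented extensionally: they take the value
  \<^const>\<open>undefined\<close> outside \<open>S\<close>.\<close>

definition pointwise_module :: "'z set \<Rightarrow> ('a, 'b) module \<Rightarrow> ('a, 'z \<Rightarrow> 'b) module" where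
  "pointwise_module S V = \<lparr>
     carrier = S \<rightarrow>\<^sub>E carrier V,
     mult = undefined,
     one = undefined,
     zero = (\<lambda>z\<in>S. \<zero>\<^bsub>V\<^esub>),
     add = (\<lambda>f g. \<lambda>z\<in>S. f z \<oplus>\<^bsub>V\<^esub> g z),
     smult = (\<lambda>c f. \<lambda>z\<in>S. c \<odot>\<^bsub>V\<^esub> f z)\<rparr>"

definition poly_module :: "(complex, complex poly) module" where
  "poly_module = \<lparr>
     carrier = UNIV,
     mult = undefined,
     one = undefined,
     zero = 0,
     add = (+),
     smult = Polynomial.smult\<rparr>"

text \<open>The representation enters only through its values on \<open>\<Gamma>\<close>.\<close>

definition Mhat :: "nat \<Rightarrow> int \<Rightarrow> (real^2^2) set \<Rightarrow> (real^2^2 \<Rightarrow> complex mat) \<Rightarrow>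
    (complex, complex \<Rightarrow> complex vec) module" where
  "Mhat N k \<Gamma> \<rho> = (pointwise_module uhp (module_vec TYPE(complex) N))
     \<lparr>carrier := {G \<in> uhp \<rightarrow>\<^sub>E carrier_vec N.
        (\<forall>i<N. (\<lambda>z. vec_index (G z) i) holomorphic_on uhp) \<and>
        (\<forall>\<gamma>\<in>\<Gamma>. \<forall>z\<in>uhp. (JJ \<gamma> z powi (- k)) \<cdot>\<^sub>v G (act \<gamma> z) = \<rho> \<gamma> *\<^sub>v G z)}\<rparr>"

text \<open>\<open>\<Phi> z\<close> is the polynomial \<open>\<Phi>(z, X)\<close> in \<open>X\<close>; composition with a linear polynomial
  substitutes \<open>J\<^sup>2 (X - K)\<close> for \<open>X\<close>.\<close>

definition QP :: "nat \<Rightarrow> int \<Rightarrow> (real^2^2) set \<Rightarrow> (complex, complex \<Rightarrow> complex poly) module" where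
  "QP m w \<Gamma> = (pointwise_module uhp poly_module)
     \<lparr>carrier := {\<Phi> \<in> uhp \<rightarrow>\<^sub>E UNIV.
        (\<forall>z\<in>uhp. degree (\<Phi> z) \<le> m) \<and>
        (\<forall>r\<le>m. (\<lambda>z. coeff (\<Phi> z) r) holomorphic_on uhp) \<and>
        (\<forall>\<gamma>\<in>\<Gamma>. \<forall>z\<in>uhp.
           Polynomial.smult (JJ \<gamma> z powi (- w))
             (\<Phi> (act \<gamma> z) \<circ>\<^sub>p Polynomial.smult ((JJ \<gamma> z)\<^sup>2) [:- KK \<gamma> z, 1:]) = \<Phi> z)}\<rparr>"


subsection \<open>The map from quasimodular polynomials to vector-valued forms\<close>

definition vhat :: "nat \<Rightarrow> complex \<Rightarrow> complex vec" where
  "vhat n z = vec (n + 1) (\<lambda>i. z ^ (n - i))"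

definition vec_deriv :: "nat \<Rightarrow> (complex \<Rightarrow> complex vec) \<Rightarrow> complex \<Rightarrow> complex vec" where
  "vec_deriv N v z = vec N (\<lambda>i. deriv (\<lambda>w. vec_index (v w) i) z)"

definition UU :: "nat \<Rightarrow> (complex \<Rightarrow> complex poly) \<Rightarrow> complex \<Rightarrow> complex vec" where
  "UU n F = (\<lambda>z\<in>uhp. finsum_vec TYPE(complex) (n + 1)
     (\<lambda>l. ((- 1) ^ n * fact (n - l) * coeff (F z) l) \<cdot>\<^sub>v (vec_deriv (n + 1) ^^ l) (vhat n) z) {..n})"

end

theory Submission
  imports Defs
begin

text \<open>Encode a vector \<open>v\<close> in \<open>\<complex>\<^sup>n\<^sup>+\<^sup>1\<close> by the binary form \<open>\<Sum>\<^sub>i (n choose i) u\<^sup>n\<^sup>-\<^sup>i t\<^sup>i v\<^sub>i\<close>.  For \<open>v = UU n F z\<close>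
  this is, up to the constant \<open>(-1)\<^sup>n n!\<close>, the homogenization \<open>\<Sum>\<^sub>l f\<^sub>l(z) u\<^sup>l (u z + t)\<^sup>n\<^sup>-\<^sup>l\<close> of \<open>F(z, X)\<close>,
  while the symmetric tensor representation acts on the forms by a linear substitution in \<open>(u, t)\<close>.
  Evaluated at \<open>u = 1\<close> and real \<open>t\<close>, the transformation law of \<open>UU n F\<close> therefore says that both
  sides of the transformation law of \<open>F\<close> agree at \<open>X = K + 1 / (J\<^sup>2 (\<gamma>z + t))\<close>.  Since \<open>\<gamma>z\<close> is
  not real, these are infinitely many points, so the two laws are equivalent.  Bijectivity amounts to expanding a polynomial in \<open>t\<close>
  in powers of \<open>z + t\<close>.\<close>

section \<open>Comparing polynomials on infinite sets and vectors through binomial weights\<close>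

lemma polyfun_eq_coeffs_infinite:
  fixes c d :: "nat \<Rightarrow> complex"
  assumes "infinite S" and "\<And>x. x \<in> S \<Longrightarrow> (\<Sum>i\<le>n. c i * x ^ i) = (\<Sum>i\<le>n. d i * x ^ i)"
    and "i \<le> n"
  shows "c i = d i"
proof (rule ccontr)
  assume "c i \<noteq> d i"
  then have "\<exists>i\<le>n. c i - d i \<noteq> 0" using \<open>i \<le> n\<close> by auto
  then have "finite {x. (\<Sum>i\<le>n. (c i - d i) * x ^ i) = 0}"
    by (subst polyfun_finite_roots)
  moreover have "S \<subseteq> {x. (\<Sum>i\<le>n. (c i - d i) * x ^ i) = 0}"
    using assms(2) by (auto simp: left_diff_distrib sum_subtractf)
  ultimately show False using \<open>infinite S\<close> finite_subset by blast
qed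

lemma poly_eqI_infinite:
  fixes p q :: "'a::idom poly"
  assumes "infinite S" and "\<And>x. x \<in> S \<Longrightarrow> poly p x = poly q x"
  shows "p = q"
proof (rule ccontr)
  assume "p \<noteq> q"
  then have "finite {x. poly (p - q) x = 0}" by (intro poly_roots_finite) auto
  moreover have "S \<subseteq> {x. poly (p - q) x = 0}" using assms(2) by auto
  ultimately show False using \<open>infinite S\<close> finite_subset by blast
qed

lemma poly_altdef_bound:
  fixes p :: "'a::comm_semiring_1 poly"
  assumes "degree p \<le> n"
  shows "poly p x = (\<Sum>l\<le>n. coeff p l * x ^ l)"
  unfolding poly_altdef using assms
  by (intro sum.mono_neutral_left) (auto simp: coeff_eq_0 not_le)

lemma coeff_sum_monom_atMost:
  "coeff (\<Sum>l\<le>n. monom (c l) l) r = (if r \<le> n then c r else 0)"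
  by (simp add: coeff_sum coeff_monom)

lemma vec_eq_iff_atMost:
  assumes "v \<in> carrier_vec (n + 1)" "w \<in> carrier_vec (n + 1)"
  shows "v = w \<longleftrightarrow> (\<forall>i\<le>n. vec_index v i = vec_index w i)"
  using assms by (auto simp: vec_eq_iff less_Suc_eq_le)

text \<open>For \<open>i \<le> n\<close> the weight \<open>n choose i\<close> is nonzero, so passing
  from a vector to its binary form loses nothing.\<close>

lemma binomial_mult_cancel:
  fixes a b :: "nat \<Rightarrow> 'a::field_char_0"
  shows "(\<forall>i\<le>n. of_nat (n choose i) * a i = of_nat (n choose i) * b i) \<longleftrightarrow> (\<forall>i\<le>n. a i = b i)"
  by (auto simp: binomial_eq_0_iff)

subsection \<open>The binomial generating function of the image\<close>

text \<open>The falling factorial from differentiating \<open>z^(n-i)\<close> is written as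
  \<open>l!\<close> times a binomial coefficient. For \<open>l > n - i\<close> this coefficient is
  0, so the truncated exponent does no harm, and the binomial form suits the summation
  below.\<close>

lemma vec_deriv_vhat:
  "(vec_deriv (n + 1) ^^ l) (vhat n) =
     (\<lambda>z. vec (n + 1) (\<lambda>i. fact l * of_nat ((n - i) choose l) * z ^ (n - i - l)))"
proof (induction l)
  case 0
  show ?case by (simp add: vhat_def fun_eq_iff)
next
  case (Suc l)
  have step: "fact l * of_nat (m choose l) * (of_nat (m - l) * z ^ (m - l - 1)) =
      fact (Suc l) * of_nat (m choose Suc l) * z ^ (m - Suc l)" for m and z :: complex
  proof -
    \<comment> \<open>Both sides equal \<open>m\<close> times
      \<open>(m - 1) choose l\<close>.\<close>
    have "(m choose l) * (m - l) = Suc l * (m choose Suc l)"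
      by (metis binomial_absorption binomial_absorb_comp mult.commute)
    then have "of_nat (m choose l) * of_nat (m - l) = (of_nat (Suc l) * of_nat (m choose Suc l) :: complex)"
      by (metis of_nat_mult)
    then have "fact l * (of_nat (m choose l) * of_nat (m - l)) * z ^ (m - Suc l) =
        fact l * (of_nat (Suc l) * of_nat (m choose Suc l)) * z ^ (m - Suc l)" by simp
    moreover have "m - l - 1 = m - Suc l" by simp
    ultimately show ?thesis by (simp only: fact_Suc mult.assoc mult.left_commute[of "of_nat (Suc l)"])
  qed
  have deriv: "deriv (\<lambda>w. fact l * of_nat (m choose l) * w ^ (m - l)) z =
      fact (Suc l) * of_nat (m choose Suc l) * z ^ (m - Suc l)" for m and z :: complex
  proof -
    have "((\<lambda>w. fact l * of_nat (m choose l) * w ^ (m - l)) has_field_derivative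
        fact l * of_nat (m choose l) * (of_nat (m - l) * z ^ (m - l - 1))) (at z)"
      by (auto intro!: derivative_eq_intros)
    from DERIV_imp_deriv[OF this] show ?thesis unfolding step .
  qed
  show ?case
    unfolding funpow.simps o_apply Suc.IH
    by (auto simp: vec_deriv_def fun_eq_iff deriv simp del: fact_Suc diff_diff_left intro!: eq_vecI)
qed

lemma UU_carrier: "z \<in> uhp \<Longrightarrow> UU n F z \<in> carrier_vec (n + 1)"
  unfolding UU_def vec_deriv_vhat by (simp, intro finsum_vec_closed) auto

lemma UU_index:
  assumes "z \<in> uhp" "i \<le> n"
  shows "vec_index (UU n F z) i = (\<Sum>l\<le>n. (-1) ^ n * fact (n - l) * coeff (F z) l *
           (fact l * of_nat ((n - i) choose l) * z ^ (n - i - l)))"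
  unfolding UU_def vec_deriv_vhat using assms
  by (simp, subst index_finsum_vec) auto

text \<open>Interchange the sums. For fixed \<open>l\<close>, the factor \<open>(n-l)!\<close> of
  \<open>UU\<close> and the \<open>l!\<close> from differentiation turn the weights into
  \<open>n!\<close> times \<open>(n-l) choose i\<close>, and the sum over \<open>i\<close> becomes
  the binomial expansion of \<open>(u z + v)^(n-l)\<close>. The remaining constant does not depend
  on \<open>l\<close>.\<close>

lemma UU_generating:
  assumes "z \<in> uhp"
  shows "(\<Sum>i\<le>n. of_nat (n choose i) * u ^ (n - i) * v ^ i * vec_index (UU n F z) i) =
         (-1) ^ n * fact n * (\<Sum>l\<le>n. coeff (F z) l * u ^ l * (u * z + v) ^ (n - l))"
proof -
  have inner: "(\<Sum>i\<le>n. of_nat (n choose i) * u ^ (n - i) * v ^ i *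
          (fact (n - l) * fact l * of_nat ((n - i) choose l) * z ^ (n - i - l))) =
        fact n * (u ^ l * (u * z + v) ^ (n - l))" if "l \<le> n" for l
  proof -
    have "(\<Sum>i\<le>n. of_nat (n choose i) * u ^ (n - i) * v ^ i *
          (fact (n - l) * fact l * of_nat ((n - i) choose l) * z ^ (n - i - l))) =
        (\<Sum>i\<le>n-l. of_nat (n choose i) * u ^ (n - i) * v ^ i *
          (fact (n - l) * fact l * of_nat ((n - i) choose l) * z ^ (n - i - l)))"
      \<comment> \<open>For \<open>i > n - l\<close> the coefficient \<open>(n-i) choose l\<close>
        is 0.\<close>
      by (rule sum.mono_neutral_right) auto
    also have "\<dots> = (\<Sum>i\<le>n-l. fact n * u ^ l * (of_nat ((n - l) choose i) * v ^ i * (u * z) ^ (n - l - i)))"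
    proof (rule sum.cong[OF refl])
      fix i assume "i \<in> {..n - l}"
      then have i: "i \<le> n - l" "i \<le> n" "l \<le> n - i" using that by auto
      have "fact (n - l) * fact l * (n choose i) * ((n - i) choose l) = fact n * ((n - l) choose i)"
      proof -
        \<comment> \<open>Both sides count pairs of disjoint subsets of sizes \<open>i\<close> and
          \<open>l\<close> in a set of size \<open>n\<close>.\<close>
        have "(n choose i) * ((n - i) choose l) = (n choose l) * ((n - l) choose i)"
          using choose_mult[of i "i + l" n] choose_mult[of l "i + l" n] i that
          by (metis add.commute add_diff_cancel_left' binomial_symmetric le_add1 le_diff_conv2)
        moreover have "fact (n - l) * fact l * (n choose l) = fact n"
          using binomial_fact_lemma[OF that] by (simp add: ac_simps)
        ultimately show ?thesis by (metis mult.assoc)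
      qed
      then have "of_nat (fact (n - l) * fact l * (n choose i) * ((n - i) choose l)) =
          (of_nat (fact n * ((n - l) choose i)) :: complex)" by simp
      then have *: "of_nat (n choose i) * (fact (n - l) * fact l * of_nat ((n - i) choose l)) =
          (fact n * of_nat ((n - l) choose i) :: complex)" by (simp add: ac_simps)
      have "u ^ (n - i) = u ^ l * u ^ (n - l - i)"
        using i by (simp flip: power_add)
      moreover have "n - i - l = n - l - i" by simp
      ultimately have "of_nat (n choose i) * u ^ (n - i) * v ^ i *
          (fact (n - l) * fact l * of_nat ((n - i) choose l) * z ^ (n - i - l)) =
          (of_nat (n choose i) * (fact (n - l) * fact l * of_nat ((n - i) choose l))) *
           (u ^ l * (v ^ i * (u * z) ^ (n - l - i)))"
        by (simp add: power_mult_distrib ac_simps)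
      then show "of_nat (n choose i) * u ^ (n - i) * v ^ i *
          (fact (n - l) * fact l * of_nat ((n - i) choose l) * z ^ (n - i - l)) =
          fact n * u ^ l * (of_nat ((n - l) choose i) * v ^ i * (u * z) ^ (n - l - i))"
        unfolding * by (simp add: ac_simps)
    qed
    also have "\<dots> = fact n * u ^ l * (v + u * z) ^ (n - l)"
      by (simp add: binomial_ring sum_distrib_left)
    finally show ?thesis by (simp add: ac_simps)
  qed
  have "(\<Sum>i\<le>n. of_nat (n choose i) * u ^ (n - i) * v ^ i * vec_index (UU n F z) i) =
      (\<Sum>i\<le>n. \<Sum>l\<le>n. (-1) ^ n * coeff (F z) l * (of_nat (n choose i) * u ^ (n - i) * v ^ i *
          (fact (n - l) * fact l * of_nat ((n - i) choose l) * z ^ (n - i - l))))"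
    using assms by (intro sum.cong refl) (simp add: UU_index sum_distrib_left ac_simps)
  also have "\<dots> = (\<Sum>l\<le>n. (-1) ^ n * coeff (F z) l * (fact n * (u ^ l * (u * z + v) ^ (n - l))))"
    by (subst sum.swap, intro sum.cong refl, subst sum_distrib_left[symmetric], subst inner) auto
  finally show ?thesis by (simp add: sum_distrib_left ac_simps)
qed

section \<open>The symmetric tensor representation on binary forms\<close>

lemma sym_rep_carrier: "sym_rep n \<gamma> \<in> carrier_mat (n + 1) (n + 1)"
  using is_sym_rep_matrix_sym_rep unfolding is_sym_rep_matrix_def by blast

text \<open>Applied to the vector of \<open>(1, y)\<close>, the defining property gives the
  generating polynomial in \<open>y\<close> of each row. Summing the rows with weights
  \<open>(n choose i) t^i\<close> yields the \<open>n\<close>-th power of a form linear in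
  \<open>y\<close>; expanding it in powers of \<open>y\<close> and comparing coefficients gives the
  columns.\<close>

lemma sym_rep_generating:
  assumes "j \<le> n"
  shows "(\<Sum>i\<le>n. of_nat (n choose i) * t ^ i * sym_rep n \<gamma> $$ (i, j)) =
     of_nat (n choose j) * (\<gamma>$1$1 + t * \<gamma>$2$1) ^ (n - j) * (\<gamma>$1$2 + t * \<gamma>$2$2) ^ j"
proof -
  let ?A = "sym_rep n \<gamma>"
  have row: "(\<Sum>j\<le>n. ?A $$ (i, j) * y ^ j) =
      (\<gamma>$1$1 + \<gamma>$1$2 * y) ^ (n - i) * (\<gamma>$2$1 + \<gamma>$2$2 * y) ^ i" if "i \<le> n" for i y
  proof -
    have "vec_index (?A *\<^sub>v sym_vec n 1 y) i =
        vec_index (sym_vec n (\<gamma>$1$1 * 1 + \<gamma>$1$2 * y) (\<gamma>$2$1 * 1 + \<gamma>$2$2 * y)) i"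
      using is_sym_rep_matrix_sym_rep unfolding is_sym_rep_matrix_def by metis
    then show ?thesis
      using that sym_rep_carrier[of n \<gamma>]
      by (auto simp: sym_vec_def scalar_prod_def atLeast0LessThan lessThan_Suc_atMost)
  qed
  have "\<forall>y. (\<Sum>j\<le>n. (\<Sum>i\<le>n. of_nat (n choose i) * t ^ i * ?A $$ (i, j)) * y ^ j) =
        (\<Sum>j\<le>n. of_nat (n choose j) * (\<gamma>$1$1 + t * \<gamma>$2$1) ^ (n - j) * (\<gamma>$1$2 + t * \<gamma>$2$2) ^ j * y ^ j)"
    (is "\<forall>y. ?lhs y = ?rhs y")
  proof
    fix y
    have "(\<Sum>j\<le>n. (\<Sum>i\<le>n. of_nat (n choose i) * t ^ i * ?A $$ (i, j)) * y ^ j) =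
        (\<Sum>i\<le>n. of_nat (n choose i) * t ^ i * (\<Sum>j\<le>n. ?A $$ (i, j) * y ^ j))"
      unfolding sum_distrib_left sum_distrib_right by (subst sum.swap) (simp add: ac_simps)
    also have "\<dots> = (\<Sum>i\<le>n. of_nat (n choose i) * (t * (\<gamma>$2$1 + \<gamma>$2$2 * y)) ^ i *
          (\<gamma>$1$1 + \<gamma>$1$2 * y) ^ (n - i))"
      by (intro sum.cong refl, subst row) (auto simp: power_mult_distrib)
    also have "\<dots> = (t * (\<gamma>$2$1 + \<gamma>$2$2 * y) + (\<gamma>$1$1 + \<gamma>$1$2 * y)) ^ n"
      by (rule binomial_ring[symmetric])
    also have "\<dots> = ((\<gamma>$1$2 + t * \<gamma>$2$2) * y + (\<gamma>$1$1 + t * \<gamma>$2$1)) ^ n"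
      by (simp add: algebra_simps)
    also have "\<dots> = (\<Sum>j\<le>n. of_nat (n choose j) * ((\<gamma>$1$2 + t * \<gamma>$2$2) * y) ^ j *
          (\<gamma>$1$1 + t * \<gamma>$2$1) ^ (n - j))"
      by (rule binomial_ring)
    finally show "?lhs y = ?rhs y" by (simp add: power_mult_distrib ac_simps)
  qed
  then show ?thesis unfolding polyfun_eq_coeffs using assms by blast
qed


subsection \<open>Equivariance\<close>

text \<open>With \<open>w = act \<gamma> z\<close> and \<open>\<gamma> = (a, b; c, d)\<close>, the
  last two identities read \<open>J w = a z + b\<close> and \<open>J (a - c w) = 1\<close>, the
  latter being the determinant condition. They rewrite the substituted variables of the binary form
  in terms of \<open>J\<close> and \<open>w + t\<close>.\<close>

lemma
  assumes "z \<in> uhp" "Determinants.det \<gamma> = 1"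
  shows JJ_nonzero: "JJ \<gamma> z \<noteq> 0"
    and act_in_uhp: "act \<gamma> z \<in> uhp"
    and JJ_mult_act: "JJ \<gamma> z * act \<gamma> z = of_real (\<gamma>$1$1) * z + of_real (\<gamma>$1$2)"
    and JJ_act_diff: "JJ \<gamma> z * (of_real (\<gamma>$1$1) - of_real (\<gamma>$2$1) * act \<gamma> z) = 1"
proof -
  have det: "\<gamma>$1$1 * \<gamma>$2$2 - \<gamma>$1$2 * \<gamma>$2$1 = 1" and Im: "Im z > 0"
    using assms by (auto simp: det_2 uhp_def)
  show J: "JJ \<gamma> z \<noteq> 0"
  proof
    assume "JJ \<gamma> z = 0"
    then have "Im (JJ \<gamma> z) = 0" "Re (JJ \<gamma> z) = 0" by simp_all
    then show False using det Im by (auto simp: JJ_def)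
  qed
  have act: "act \<gamma> z = (of_real (\<gamma>$1$1) * z + of_real (\<gamma>$1$2)) / JJ \<gamma> z"
    by (simp add: act_def moebius_def JJ_def)
  show Ja: "JJ \<gamma> z * act \<gamma> z = of_real (\<gamma>$1$1) * z + of_real (\<gamma>$1$2)"
    using J by (simp add: act)
  have "Im ((of_real (\<gamma>$1$1) * z + of_real (\<gamma>$1$2)) * cnj (JJ \<gamma> z)) =
      (\<gamma>$1$1 * \<gamma>$2$2 - \<gamma>$1$2 * \<gamma>$2$1) * Im z"
    by (simp add: JJ_def algebra_simps)
  then show "act \<gamma> z \<in> uhp"
    using det Im by (simp add: uhp_def act Im_complex_div_gt_0)
  have "JJ \<gamma> z * (of_real (\<gamma>$1$1) - of_real (\<gamma>$2$1) * act \<gamma> z) =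
      of_real (\<gamma>$1$1) * JJ \<gamma> z - of_real (\<gamma>$2$1) * (JJ \<gamma> z * act \<gamma> z)"
    by (simp add: algebra_simps)
  also have "\<dots> = of_real (\<gamma>$1$1 * \<gamma>$2$2 - \<gamma>$1$2 * \<gamma>$2$1)"
    unfolding Ja by (simp add: JJ_def algebra_simps)
  finally show "JJ \<gamma> z * (of_real (\<gamma>$1$1) - of_real (\<gamma>$2$1) * act \<gamma> z) = 1"
    using det by simp
qed

text \<open>On binary forms the representation becomes the substitution of
  \<open>(a + t c, b + t d)\<close> for \<open>(1, t)\<close>. The parameter \<open>t\<close> is
  real because \<open>sym_rep\<close> is a real matrix, characterized by real identities.\<close>

lemma sym_rep_mult_generating:
  assumes "v \<in> carrier_vec (n + 1)"
  shows "(\<Sum>i\<le>n. of_nat (n choose i) * of_real t ^ i *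
            vec_index (map_mat complex_of_real (sym_rep n \<gamma>) *\<^sub>v v) i) =
         (\<Sum>j\<le>n. of_nat (n choose j) * of_real (\<gamma>$1$1 + t * \<gamma>$2$1) ^ (n - j) *
            of_real (\<gamma>$1$2 + t * \<gamma>$2$2) ^ j * vec_index v j)"
proof -
  let ?A = "sym_rep n \<gamma>"
  have "vec_index (map_mat complex_of_real ?A *\<^sub>v v) i = (\<Sum>j\<le>n. of_real (?A $$ (i, j)) * vec_index v j)"
    if "i \<le> n" for i
    using that assms sym_rep_carrier[of n \<gamma>]
    by (auto simp: scalar_prod_def atLeast0LessThan lessThan_Suc_atMost)
  then have "(\<Sum>i\<le>n. of_nat (n choose i) * of_real t ^ i *
            vec_index (map_mat complex_of_real ?A *\<^sub>v v) i) =
      (\<Sum>i\<le>n. \<Sum>j\<le>n. of_real (of_nat (n choose i) * t ^ i * ?A $$ (i, j)) * vec_index v j)"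
    by (intro sum.cong refl) (simp add: sum_distrib_left ac_simps)
  also have "\<dots> = (\<Sum>j\<le>n. of_real (\<Sum>i\<le>n. of_nat (n choose i) * t ^ i * ?A $$ (i, j)) * vec_index v j)"
    by (subst sum.swap) (simp add: sum_distrib_right)
  also have "\<dots> = (\<Sum>j\<le>n. of_real (of_nat (n choose j) * (\<gamma>$1$1 + t * \<gamma>$2$1) ^ (n - j) *
            (\<gamma>$1$2 + t * \<gamma>$2$2) ^ j) * vec_index v j)"
    by (intro sum.cong refl, subst sym_rep_generating) auto
  finally show ?thesis by simp
qed

text \<open>This leads from the binary form back to the polynomial: a form in \<open>(u, T)\<close>
  is \<open>T^n\<close> times the polynomial at \<open>x = u / T\<close>.\<close>

lemma homogenized_poly:
  fixes p :: "'a::field poly"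
  assumes "degree p \<le> n" "T \<noteq> 0"
  shows "(\<Sum>l\<le>n. coeff p l * (T * x) ^ l * T ^ (n - l)) = T ^ n * poly p x"
proof -
  have "(T * x) ^ l * T ^ (n - l) = T ^ n * x ^ l" if "l \<le> n" for l
    using that power_add[of T l "n - l"] by (simp add: power_mult_distrib ac_simps)
  then show ?thesis
    unfolding poly_altdef_bound[OF assms(1)] sum_distrib_left
    by (intro sum.cong refl) (simp add: ac_simps)
qed

text \<open>The equivalence holds for each \<open>\<gamma>\<close> and \<open>z\<close> separately
  and serves in both directions: left from right to see that \<open>UU\<close> lands in the target,
  right from left to see that the inverse does. The shift of the weight from \<open>k\<close> to
  \<open>k + n\<close> comes from the factor \<open>J^n\<close> of the homogenization.\<close>

lemma UU_equivariant_iff: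
  assumes z: "z \<in> uhp" and det: "Determinants.det \<gamma> = 1"
    and deg: "degree (F z) \<le> n" "degree (F (act \<gamma> z)) \<le> n"
  shows "(JJ \<gamma> z powi (- k)) \<cdot>\<^sub>v UU n F (act \<gamma> z) =
           map_mat complex_of_real (sym_rep n \<gamma>) *\<^sub>v UU n F z \<longleftrightarrow>
         Polynomial.smult (JJ \<gamma> z powi (- (k + int n)))
             (F (act \<gamma> z) \<circ>\<^sub>p Polynomial.smult ((JJ \<gamma> z)\<^sup>2) [:- KK \<gamma> z, 1:]) = F z"
    (is "?L = ?R \<longleftrightarrow> ?P = F z")
proof -
  define J where "J = JJ \<gamma> z"
  define K where "K = KK \<gamma> z"
  define w where "w = act \<gamma> z"
  \<comment> \<open>This point meets two demands at once: \<open>J^2 (x - K) = 1 / (w + t)\<close>,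
    the argument at which the form of \<open>F w\<close> is evaluated, and
    \<open>x = (a + t c) / (J (w + t))\<close>, the argument for \<open>F z\<close>.\<close>
  define x where "x t = K + 1 / (J\<^sup>2 * (w + of_real t))" for t
  note w = act_in_uhp[OF z det, folded w_def]
  have J0: "J \<noteq> 0" using JJ_nonzero[OF z det] by (simp add: J_def)
  have T0: "w + of_real t \<noteq> 0" for t
  proof
    assume "w + of_real t = 0"
    then have "Im (w + of_real t) = 0" by simp
    then show False using w by (simp add: uhp_def)
  qed
  have carr: "?L \<in> carrier_vec (n + 1)" "?R \<in> carrier_vec (n + 1)"
    using UU_carrier[OF z, of n F] UU_carrier[OF w, of n F] sym_rep_carrier[of n \<gamma>]
    by (auto simp: w_def)
  have L: "(\<Sum>i\<le>n. of_nat (n choose i) * vec_index ?L i * of_real t ^ i) =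
      (-1) ^ n * fact n * (w + of_real t) ^ n * J ^ n * poly ?P (x t)" for t :: real
  proof -
    let ?T = "w + of_real t"
    have "vec_index ?L i = J powi (- k) * vec_index (UU n F w) i" if "i \<le> n" for i
      using that UU_carrier[OF w, of n F] by (simp add: J_def w_def)
    then have "(\<Sum>i\<le>n. of_nat (n choose i) * vec_index ?L i * of_real t ^ i) =
       J powi (- k) * (\<Sum>i\<le>n. of_nat (n choose i) * 1 ^ (n - i) * of_real t ^ i * vec_index (UU n F w) i)"
      unfolding sum_distrib_left by (intro sum.cong refl) (simp add: ac_simps)
    \<comment> \<open>This is the generating function at \<open>u = 1\<close>, with 1 written as
      \<open>?T * (1 / ?T)\<close> to fit \<open>homogenized_poly\<close>.\<close>
    also have "(\<Sum>i\<le>n. of_nat (n choose i) * 1 ^ (n - i) * of_real t ^ i * vec_index (UU n F w) i) =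
        (-1) ^ n * fact n * (\<Sum>l\<le>n. coeff (F w) l * (?T * (1 / ?T)) ^ l * ?T ^ (n - l))"
      unfolding UU_generating[OF w] using T0[of t] by simp
    also have "\<dots> = (-1) ^ n * fact n * (?T ^ n * poly (F w) (1 / ?T))"
      using deg(2) T0[of t] by (subst homogenized_poly) (auto simp: w_def)
    also have "1 / ?T = J\<^sup>2 * (x t - K)"
      using J0 by (simp add: x_def)
    \<comment> \<open>Splitting off \<open>J^n\<close> leaves the weight of the quasimodular law and
      produces the common factor that also appears in \<open>R\<close>.\<close>
    also have "J powi (- k) = J ^ n * J powi (- (k + int n))"
      using J0 power_int_add[of J "int n" "- (k + int n)"] by simp
    finally show ?thesis
      by (simp add: poly_pcompose J_def[symmetric] K_def[symmetric] w_def[symmetric] algebra_simps)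
  qed
  have R: "(\<Sum>i\<le>n. of_nat (n choose i) * vec_index ?R i * of_real t ^ i) =
      (-1) ^ n * fact n * (w + of_real t) ^ n * J ^ n * poly (F z) (x t)" for t :: real
  proof -
    let ?T = "w + of_real t"
    let ?u = "complex_of_real (\<gamma>$1$1 + t * \<gamma>$2$1)"
    let ?v = "complex_of_real (\<gamma>$1$2 + t * \<gamma>$2$2)"
    have uv: "?u * z + ?v = J * ?T"
      using JJ_mult_act[OF z det] by (simp add: JJ_def J_def w_def algebra_simps)
    \<comment> \<open>Write \<open>a + t c = (a - c w) + c (w + t)\<close> and use
      \<open>a - c w = 1 / J\<close>.\<close>
    have "?u = 1 / J + of_real (\<gamma>$2$1) * ?T"
      using JJ_act_diff[OF z det] J0 by (simp add: J_def w_def field_simps)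
    also have "\<dots> = J * ?T * x t"
    proof -
      have "1 / J + c * T = J * T * (c / J + 1 / (J\<^sup>2 * T))" if "T \<noteq> 0" for c T
        using J0 that by (simp add: field_simps power2_eq_square)
      from this[OF T0] show ?thesis by (simp add: x_def K_def KK_def J_def)
    qed
    finally have u: "?u = J * ?T * x t" .
    have "(\<Sum>i\<le>n. of_nat (n choose i) * vec_index ?R i * of_real t ^ i) =
        (-1) ^ n * fact n * (\<Sum>l\<le>n. coeff (F z) l * ?u ^ l * (?u * z + ?v) ^ (n - l))"
      using sym_rep_mult_generating[OF UU_carrier[OF z], of n t \<gamma> F]
      unfolding UU_generating[OF z] by (simp only: mult_ac)
    also have "\<dots> = (-1) ^ n * fact n * ((J * ?T) ^ n * poly (F z) (x t))"
      \<comment> \<open>The order matters: \<open>uv\<close> contains \<open>?u\<close> and has to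
        be applied before \<open>?u\<close> is rewritten.\<close>
      unfolding uv unfolding u using deg(1) J0 T0[of t] by (subst homogenized_poly) auto
    finally show ?thesis by (simp add: power_mult_distrib)
  qed
  have inj: "inj x"
    using J0 T0 by (auto simp: inj_on_def x_def)
  have "?L = ?R \<longleftrightarrow> (\<forall>i\<le>n. of_nat (n choose i) * vec_index ?L i = of_nat (n choose i) * vec_index ?R i)"
    unfolding vec_eq_iff_atMost[OF carr] binomial_mult_cancel ..
  also have "\<dots> \<longleftrightarrow> (\<forall>t. (\<Sum>i\<le>n. of_nat (n choose i) * vec_index ?L i * of_real t ^ i) =
      (\<Sum>i\<le>n. of_nat (n choose i) * vec_index ?R i * of_real t ^ i))" (is "_ \<longleftrightarrow> ?Q")
  proof
    assume Q: ?Q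
    show "\<forall>i\<le>n. of_nat (n choose i) * vec_index ?L i = of_nat (n choose i) * vec_index ?R i"
    proof (intro allI impI)
      fix i assume "i \<le> n"
      \<comment> \<open>The identity is known for real \<open>t\<close> only, while the coefficients
        are complex; the reals are an infinite set, which suffices.\<close>
      show "of_nat (n choose i) * vec_index ?L i = of_nat (n choose i) * vec_index ?R i"
      proof (rule polyfun_eq_coeffs_infinite[where S = "range complex_of_real" and n = n
            and c = "\<lambda>i. of_nat (n choose i) * vec_index ?L i"
            and d = "\<lambda>i. of_nat (n choose i) * vec_index ?R i"])
        show "infinite (range complex_of_real)"
          by (simp add: finite_image_iff inj_on_def infinite_UNIV_char_0)
      qed (use Q \<open>i \<le> n\<close> in blast)+
    qed
  qed simp
  also have "\<dots> \<longleftrightarrow> (\<forall>t. poly ?P (x t) = poly (F z) (x t))"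
    unfolding L R using J0 T0 by simp
  also have "\<dots> \<longleftrightarrow> ?P = F z"
  proof
    assume "\<forall>t. poly ?P (x t) = poly (F z) (x t)"
    moreover have "infinite (range x)"
      using inj by (simp add: finite_image_iff infinite_UNIV_char_0)
    ultimately show "?P = F z" by (intro poly_eqI_infinite[of "range x"]) blast+
  qed metis
  finally show ?thesis .
qed

subsection \<open>Bijectivity\<close>

text \<open>The generating function at \<open>u = 1\<close> turns a vector equation at
  \<open>z\<close> into one polynomial identity in a complex variable \<open>t\<close>. No group
  element is involved.\<close>

lemma UU_eq_iff:
  assumes z: "z \<in> uhp" and v: "v \<in> carrier_vec (n + 1)"
  shows "UU n F z = v \<longleftrightarrow> (\<forall>t. (-1) ^ n * fact n * (\<Sum>l\<le>n. coeff (F z) l * (z + t) ^ (n - l)) =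
           (\<Sum>i\<le>n. of_nat (n choose i) * vec_index v i * t ^ i))" (is "_ \<longleftrightarrow> ?Q")
proof -
  have gen: "(-1) ^ n * fact n * (\<Sum>l\<le>n. coeff (F z) l * (z + t) ^ (n - l)) =
      (\<Sum>i\<le>n. of_nat (n choose i) * vec_index (UU n F z) i * t ^ i)" for t
    using UU_generating[OF z, of n 1 t F] by (simp add: ac_simps)
  have "UU n F z = v \<longleftrightarrow>
      (\<forall>i\<le>n. of_nat (n choose i) * vec_index (UU n F z) i = of_nat (n choose i) * vec_index v i)"
    unfolding vec_eq_iff_atMost[OF UU_carrier[OF z] v] binomial_mult_cancel ..
  also have "\<dots> \<longleftrightarrow> ?Q"
    unfolding gen by (rule polyfun_eq_coeffs[symmetric])
  finally show ?thesis .
qed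

text \<open>In the variable \<open>s = z + t\<close> the binary form has
  \<open>coeff (F z) l\<close> as coefficient of \<open>s^(n-l)\<close>, up to a nonzero constant,
  so the coefficients can be read off.\<close>

lemma UU_inj:
  assumes z: "z \<in> uhp" and deg: "degree (F z) \<le> n" "degree (F' z) \<le> n"
    and eq: "UU n F z = UU n F' z"
  shows "F z = F' z"
proof -
  have rev: "(\<Sum>l\<le>n. c l * s ^ (n - l)) = (\<Sum>l\<le>n. c (n - l) * s ^ l)" for c and s :: complex
    by (rule sum.reindex_bij_witness[where i = "\<lambda>l. n - l" and j = "\<lambda>l. n - l"]) auto
  have "\<forall>s. (\<Sum>l\<le>n. coeff (F z) (n - l) * s ^ l) = (\<Sum>l\<le>n. coeff (F' z) (n - l) * s ^ l)"
    (is "\<forall>s. ?lhs s = ?rhs s")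
  proof
    fix s
    have "(-1) ^ n * fact n * (\<Sum>l\<le>n. coeff (F z) l * (z + (s - z)) ^ (n - l)) =
        (-1) ^ n * fact n * (\<Sum>l\<le>n. coeff (F' z) l * (z + (s - z)) ^ (n - l))"
      using UU_eq_iff[OF z UU_carrier[OF z, of n F'], of F, THEN iffD1, OF eq, THEN spec, of "s - z"]
        UU_eq_iff[OF z UU_carrier[OF z, of n F'], of F', THEN iffD1, OF refl, THEN spec, of "s - z"]
      by (simp only:)
    then show "?lhs s = ?rhs s" by (simp add: rev)
  qed
  then have *: "\<forall>l\<le>n. coeff (F z) (n - l) = coeff (F' z) (n - l)"
    unfolding polyfun_eq_coeffs .
  show ?thesis
  proof (rule poly_eqI)
    fix r
    show "coeff (F z) r = coeff (F' z) r"
      using *[rule_format, of "n - r"] deg by (cases "r \<le> n") (auto simp: coeff_eq_0)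
  qed
qed

text \<open>The coefficients come from expanding \<open>\<Sum>\<^sub>i (n choose i) G\<^sub>i(z) t\<^sup>i\<close> in powers of \<open>s = z + t\<close>.  The
  terms with \<open>i < n - l\<close>, where the exponent is truncated, carry a vanishing binomial coefficient.\<close>

definition UU_inv :: "nat \<Rightarrow> (complex \<Rightarrow> complex vec) \<Rightarrow> complex \<Rightarrow> complex poly" where
  "UU_inv n G = (\<lambda>z\<in>uhp. \<Sum>l\<le>n. monom ((-1) ^ n / fact n *
     (\<Sum>i\<le>n. of_nat (n choose i) * of_nat (i choose (n - l)) * (- z) ^ (i - (n - l)) *
        vec_index (G z) i)) l)"

lemma degree_UU_inv: "z \<in> uhp \<Longrightarrow> degree (UU_inv n G z) \<le> n"
  unfolding UU_inv_def by (auto intro!: degree_sum_le order.trans[OF degree_monom_le])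

text \<open>By the binomial theorem for \<open>t^i = ((z + t) + (- z))^i\<close>, the coefficients
  chosen in \<open>UU_inv\<close> reproduce the binary form of \<open>G z\<close>.\<close>

lemma UU_UU_inv:
  assumes z: "z \<in> uhp" and G: "G z \<in> carrier_vec (n + 1)"
  shows "UU n (UU_inv n G) z = G z"
proof -
  let ?g = "\<lambda>i. of_nat (n choose i) * vec_index (G z) i"
  have "(-1) ^ n * fact n * (\<Sum>l\<le>n. coeff (UU_inv n G z) l * (z + t) ^ (n - l)) =
      (\<Sum>i\<le>n. ?g i * t ^ i)" for t
  proof -
    have cancel: "(-1) ^ n * fact n * ((-1) ^ n / fact n * s) = s" for s :: complex
      by (simp add: power_mult_distrib[symmetric] flip: power_add mult_2)
    have "(-1) ^ n * fact n * (\<Sum>l\<le>n. coeff (UU_inv n G z) l * (z + t) ^ (n - l)) =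
       (\<Sum>l\<le>n. \<Sum>i\<le>n. ?g i * (of_nat (i choose (n - l)) * (z + t) ^ (n - l) * (- z) ^ (i - (n - l))))"
    proof -
      have "(-1) ^ n * fact n * (coeff (UU_inv n G z) l * (z + t) ^ (n - l)) =
          (\<Sum>i\<le>n. ?g i * (of_nat (i choose (n - l)) * (z + t) ^ (n - l) * (- z) ^ (i - (n - l))))"
        if "l \<le> n" for l
      proof -
        let ?c = "\<Sum>i\<le>n. of_nat (n choose i) * of_nat (i choose (n - l)) * (- z) ^ (i - (n - l)) *
          vec_index (G z) i"
        have "coeff (UU_inv n G z) l = (-1) ^ n / fact n * ?c"
          using z that unfolding UU_inv_def by (simp only: restrict_apply' coeff_sum_monom_atMost if_True)
        then have "(-1) ^ n * fact n * (coeff (UU_inv n G z) l * (z + t) ^ (n - l)) =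
            (-1) ^ n * fact n * ((-1) ^ n / fact n * ?c) * (z + t) ^ (n - l)"
          by (simp only: mult.assoc)
        also have "\<dots> = ?c * (z + t) ^ (n - l)"
          by (simp only: cancel)
        also have "\<dots> = (\<Sum>i\<le>n. ?g i * (of_nat (i choose (n - l)) * (z + t) ^ (n - l) * (- z) ^ (i - (n - l))))"
          unfolding sum_distrib_right by (intro sum.cong refl) (simp only: mult_ac)
        finally show ?thesis .
      qed
      then show ?thesis unfolding sum_distrib_left[of "(-1) ^ n * fact n"] by (intro sum.cong refl) simp
    qed
    also have "\<dots> = (\<Sum>i\<le>n. ?g i * (\<Sum>l\<le>n. of_nat (i choose (n - l)) * (z + t) ^ (n - l) * (- z) ^ (i - (n - l))))"
      by (subst sum.swap) (simp add: sum_distrib_left)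
    also have "\<dots> = (\<Sum>i\<le>n. ?g i * t ^ i)"
    proof (intro sum.cong refl)
      fix i assume i: "i \<in> {..n}"
      \<comment> \<open>Put \<open>m = n - l\<close>; the terms with \<open>m > i\<close> then
        vanish, and the rest is the binomial expansion.\<close>
      have "(\<Sum>l\<le>n. of_nat (i choose (n - l)) * (z + t) ^ (n - l) * (- z) ^ (i - (n - l))) =
          (\<Sum>m\<le>n. of_nat (i choose m) * (z + t) ^ m * (- z) ^ (i - m))"
        by (rule sum.reindex_bij_witness[where i = "\<lambda>l. n - l" and j = "\<lambda>l. n - l"]) auto
      also have "\<dots> = (\<Sum>m\<le>i. of_nat (i choose m) * (z + t) ^ m * (- z) ^ (i - m))"
        using i by (intro sum.mono_neutral_right) auto
      also have "\<dots> = ((z + t) + (- z)) ^ i" by (rule binomial_ring[symmetric])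
      finally show "?g i * (\<Sum>l\<le>n. of_nat (i choose (n - l)) * (z + t) ^ (n - l) * (- z) ^ (i - (n - l))) =
          ?g i * t ^ i" by simp
    qed
    finally show ?thesis .
  qed
  then show ?thesis using UU_eq_iff[OF z G] by blast
qed

section \<open>Holomorphy of the map and of its inverse\<close>

lemma UU_holomorphic:
  assumes "\<And>r. r \<le> n \<Longrightarrow> (\<lambda>z. coeff (F z) r) holomorphic_on uhp" and "i \<le> n"
  shows "(\<lambda>z. vec_index (UU n F z) i) holomorphic_on uhp"
proof -
  have "(\<lambda>z. \<Sum>l\<le>n. (-1) ^ n * fact (n - l) * coeff (F z) l *
           (fact l * of_nat ((n - i) choose l) * z ^ (n - i - l))) holomorphic_on uhp"
    using assms(1) by (auto intro!: holomorphic_intros)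
  then show ?thesis
    by (rule holomorphic_transform) (use assms(2) in \<open>simp add: UU_index\<close>)
qed

lemma UU_inv_holomorphic:
  assumes "\<And>i. i \<le> n \<Longrightarrow> (\<lambda>z. vec_index (G z) i) holomorphic_on uhp" and "r \<le> n"
  shows "(\<lambda>z. coeff (UU_inv n G z) r) holomorphic_on uhp"
proof -
  have "(\<lambda>z. (-1) ^ n / fact n *
     (\<Sum>i\<le>n. of_nat (n choose i) * of_nat (i choose (n - r)) * (- z) ^ (i - (n - r)) *
        vec_index (G z) i)) holomorphic_on uhp"
    using assms(1) by (auto intro!: holomorphic_intros)
  then show ?thesis
    by (rule holomorphic_transform) (use assms(2) in \<open>simp add: UU_inv_def coeff_sum_monom_atMost\<close>)
qed

subsection \<open>Linear structure\<close>

lemma vectorspace_pointwise_module: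
  assumes "vectorspace K V"
  shows "vectorspace K (pointwise_module S V)"
proof -
  interpret V: vectorspace K V by fact
  have "abelian_group (pointwise_module S V)"
  proof (rule abelian_groupI)
    fix f assume f: "f \<in> carrier (pointwise_module S V)"
    show "\<exists>g\<in>carrier (pointwise_module S V).
        g \<oplus>\<^bsub>pointwise_module S V\<^esub> f = \<zero>\<^bsub>pointwise_module S V\<^esub>"
      \<comment> \<open>The negative is restricted to \<open>S\<close> so that it is again
        extensional.\<close>
      using f by (intro bexI[of _ "\<lambda>z\<in>S. \<ominus>\<^bsub>V\<^esub> f z"])
        (auto simp: pointwise_module_def fun_eq_iff V.M.l_neg PiE_iff)
  qed (auto simp: pointwise_module_def fun_eq_iff PiE_iff extensional_def V.M.a_assoc intro: V.M.a_comm)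
  then have "module K (pointwise_module S V)"
    by (intro moduleI V.R.is_cring)
      (auto simp: pointwise_module_def fun_eq_iff PiE_iff extensional_def V.smult_l_distr V.smult_r_distr V.smult_assoc1)
  then show ?thesis
    by (simp add: vectorspace_def V.field_axioms)
qed

lemma vectorspace_poly_module: "vectorspace class_ring poly_module"
proof -
  have "abelian_group poly_module"
    by (rule abelian_groupI) (auto simp: poly_module_def intro!: exI[of _ "- _"])
  then have "module class_ring poly_module"
    using class_field by (intro moduleI)
      (auto simp: poly_module_def smult_add_left smult_add_right field_def domain_def)
  then show ?thesis
    by (simp add: vectorspace_def class_field)
qed

text \<open>Both \<open>QP\<close> and \<open>Mhat\<close> arise from a full function space by a
  carrier update, so their vector space structure reduces to three closure properties.\<close>

lemma vectorspace_restrict_carrier: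
  assumes "vectorspace K V" and "C \<subseteq> carrier V" and "\<zero>\<^bsub>V\<^esub> \<in> C"
    and "\<And>v w. v \<in> C \<Longrightarrow> w \<in> C \<Longrightarrow> v \<oplus>\<^bsub>V\<^esub> w \<in> C"
    and "\<And>c v. c \<in> carrier K \<Longrightarrow> v \<in> C \<Longrightarrow> c \<odot>\<^bsub>V\<^esub> v \<in> C"
  shows "vectorspace K (V\<lparr>carrier := C\<rparr>)"
proof -
  interpret V: vectorspace K V by fact
  show ?thesis
    using assms by (intro V.subspace_is_vs subspace.intro submodule.intro V.module_axioms) auto
qed

lemma carrier_QP:
  "\<Phi> \<in> carrier (QP m w \<Gamma>) \<longleftrightarrow> \<Phi> \<in> uhp \<rightarrow>\<^sub>E UNIV \<and> (\<forall>z\<in>uhp. degree (\<Phi> z) \<le> m) \<and>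
     (\<forall>r\<le>m. (\<lambda>z. coeff (\<Phi> z) r) holomorphic_on uhp) \<and>
     (\<forall>\<gamma>\<in>\<Gamma>. \<forall>z\<in>uhp. Polynomial.smult (JJ \<gamma> z powi (- w))
        (\<Phi> (act \<gamma> z) \<circ>\<^sub>p Polynomial.smult ((JJ \<gamma> z)\<^sup>2) [:- KK \<gamma> z, 1:]) = \<Phi> z)"
  by (simp add: QP_def)

lemma carrier_Mhat:
  "G \<in> carrier (Mhat N k \<Gamma> \<rho>) \<longleftrightarrow> G \<in> uhp \<rightarrow>\<^sub>E carrier_vec N \<and>
     (\<forall>i<N. (\<lambda>z. vec_index (G z) i) holomorphic_on uhp) \<and>
     (\<forall>\<gamma>\<in>\<Gamma>. \<forall>z\<in>uhp. (JJ \<gamma> z powi (- k)) \<cdot>\<^sub>v G (act \<gamma> z) = \<rho> \<gamma> *\<^sub>v G z)"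
  by (simp add: Mhat_def)

lemma add_QP: "F \<oplus>\<^bsub>QP m w \<Gamma>\<^esub> F' = (\<lambda>z\<in>uhp. F z + F' z)"
  and smult_QP: "c \<odot>\<^bsub>QP m w \<Gamma>\<^esub> F = (\<lambda>z\<in>uhp. Polynomial.smult c (F z))"
  by (simp_all add: QP_def pointwise_module_def poly_module_def)

lemma add_Mhat: "G \<oplus>\<^bsub>Mhat N k \<Gamma> \<rho>\<^esub> G' = (\<lambda>z\<in>uhp. G z + G' z)"
  and smult_Mhat: "c \<odot>\<^bsub>Mhat N k \<Gamma> \<rho>\<^esub> G = (\<lambda>z\<in>uhp. c \<cdot>\<^sub>v G z)"
  by (simp_all add: Mhat_def pointwise_module_def module_vec_simps)

text \<open>The transformation law is linear in the polynomial. It evaluates a function restricted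
  to \<open>uhp\<close> at \<open>act \<gamma> z\<close>, which is why \<open>act\<close> has to
  preserve \<open>uhp\<close>.\<close>

lemma vectorspace_QP:
  assumes act: "\<And>\<gamma> z. \<gamma> \<in> \<Gamma> \<Longrightarrow> z \<in> uhp \<Longrightarrow> act \<gamma> z \<in> uhp"
  shows "vectorspace class_ring (QP m w \<Gamma>)"
proof -
  \<comment> \<open>Holomorphy depends only on values in \<open>uhp\<close>, so a restricted
    function may be replaced by its body.\<close>
  have hol: "f holomorphic_on uhp" if "g holomorphic_on uhp" "\<And>z. z \<in> uhp \<Longrightarrow> f z = g z" for f g
    using that(1) by (rule holomorphic_transform) (simp add: that(2))
  have add: "(\<lambda>z\<in>uhp. F z + F' z) \<in> carrier (QP m w \<Gamma>)"
    if F: "F \<in> carrier (QP m w \<Gamma>)" and F': "F' \<in> carrier (QP m w \<Gamma>)" for F F'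
  proof -
    have "(\<lambda>z. coeff ((\<lambda>z\<in>uhp. F z + F' z) z) r) holomorphic_on uhp" if "r \<le> m" for r
      by (rule hol[of "\<lambda>z. coeff (F z) r + coeff (F' z) r"], intro holomorphic_intros)
        (use F F' that in \<open>auto simp: carrier_QP\<close>)
    then show ?thesis
      using F F' unfolding carrier_QP
      by (auto simp: act degree_add_le pcompose_add smult_add_right)
  qed
  have smult: "(\<lambda>z\<in>uhp. Polynomial.smult c (F z)) \<in> carrier (QP m w \<Gamma>)"
    if F: "F \<in> carrier (QP m w \<Gamma>)" for F c
  proof -
    have "(\<lambda>z. coeff ((\<lambda>z\<in>uhp. Polynomial.smult c (F z)) z) r) holomorphic_on uhp" if "r \<le> m" for r
      by (rule hol[of "\<lambda>z. c * coeff (F z) r"], intro holomorphic_intros)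
        (use F that in \<open>auto simp: carrier_QP\<close>)
    moreover have "Polynomial.smult (JJ \<gamma> z powi (- w)) (Polynomial.smult c (F (act \<gamma> z)) \<circ>\<^sub>p
        Polynomial.smult ((JJ \<gamma> z)\<^sup>2) [:- KK \<gamma> z, 1:]) = Polynomial.smult c (F z)"
      if "\<gamma> \<in> \<Gamma>" "z \<in> uhp" for \<gamma> z
    proof -
      have "Polynomial.smult (JJ \<gamma> z powi (- w))
          (F (act \<gamma> z) \<circ>\<^sub>p Polynomial.smult ((JJ \<gamma> z)\<^sup>2) [:- KK \<gamma> z, 1:]) = F z"
        using F that by (simp add: carrier_QP)
      then show ?thesis
        by (metis pcompose_smult smult_smult mult.commute)
    qed
    ultimately show ?thesis
      using F unfolding carrier_QP
      by (simp add: act order.trans[OF degree_smult_le] del: pCons_0_0 smult_pCons)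
  qed
  have zero: "(\<lambda>z\<in>uhp. 0) \<in> carrier (QP m w \<Gamma>)"
    unfolding carrier_QP
  proof (intro conjI allI impI ballI)
    show "(\<lambda>z. coeff ((\<lambda>z\<in>uhp. 0) z) r) holomorphic_on uhp" for r
      by (rule hol[OF holomorphic_on_const[of 0]]) simp
  qed (simp_all add: act)
  show ?thesis
    unfolding QP_def
    by (rule vectorspace_restrict_carrier[OF vectorspace_pointwise_module[OF vectorspace_poly_module]])
      (use add smult zero in \<open>simp_all add: QP_def pointwise_module_def poly_module_def\<close>)
qed

text \<open>The dimensions of \<open>\<rho> \<gamma>\<close> let the matrix product distribute over
  sums and scalars, which makes the transformation law linear.\<close>

lemma vectorspace_Mhat:
  assumes act: "\<And>\<gamma> z. \<gamma> \<in> \<Gamma> \<Longrightarrow> z \<in> uhp \<Longrightarrow> act \<gamma> z \<in> uhp"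
    and rho: "\<And>\<gamma>. \<gamma> \<in> \<Gamma> \<Longrightarrow> \<rho> \<gamma> \<in> carrier_mat N N"
  shows "vectorspace class_ring (Mhat N k \<Gamma> \<rho>)"
proof -
  have hol: "f holomorphic_on uhp" if "g holomorphic_on uhp" "\<And>z. z \<in> uhp \<Longrightarrow> f z = g z" for f g
    using that(1) by (rule holomorphic_transform) (simp add: that(2))
  have val: "G z \<in> carrier_vec N" if "G \<in> carrier (Mhat N k \<Gamma> \<rho>)" "z \<in> uhp" for G z
    using that by (auto simp: carrier_Mhat)
  have equiv: "(JJ \<gamma> z powi (- k)) \<cdot>\<^sub>v G (act \<gamma> z) = \<rho> \<gamma> *\<^sub>v G z"
    if "G \<in> carrier (Mhat N k \<Gamma> \<rho>)" "z \<in> uhp" "\<gamma> \<in> \<Gamma>" for G z \<gamma>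
    using that by (auto simp: carrier_Mhat)
  have add: "(\<lambda>z\<in>uhp. G z + G' z) \<in> carrier (Mhat N k \<Gamma> \<rho>)"
    if G: "G \<in> carrier (Mhat N k \<Gamma> \<rho>)" and G': "G' \<in> carrier (Mhat N k \<Gamma> \<rho>)" for G G'
    unfolding carrier_Mhat
  proof (intro conjI allI impI ballI)
    show "(\<lambda>z\<in>uhp. G z + G' z) \<in> uhp \<rightarrow>\<^sub>E carrier_vec N"
      using val[OF G] val[OF G'] by auto
    show "(\<lambda>z. vec_index ((\<lambda>z\<in>uhp. G z + G' z) z) i) holomorphic_on uhp" if "i < N" for i
      by (rule hol[of "\<lambda>z. vec_index (G z) i + vec_index (G' z) i"], intro holomorphic_intros)
        (use G G' that carrier_vecD[OF val[OF G']] in \<open>auto simp: carrier_Mhat\<close>)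
    show "(JJ \<gamma> z powi (- k)) \<cdot>\<^sub>v (\<lambda>z\<in>uhp. G z + G' z) (act \<gamma> z) = \<rho> \<gamma> *\<^sub>v (\<lambda>z\<in>uhp. G z + G' z) z"
      if "\<gamma> \<in> \<Gamma>" "z \<in> uhp" for \<gamma> z
      using that act[OF that] val[OF G] val[OF G'] equiv[OF G] equiv[OF G']
      by (simp add: smult_add_distrib_vec[where n = N] mult_add_distrib_mat_vec[OF rho])
  qed
  have smult: "(\<lambda>z\<in>uhp. c \<cdot>\<^sub>v G z) \<in> carrier (Mhat N k \<Gamma> \<rho>)"
    if G: "G \<in> carrier (Mhat N k \<Gamma> \<rho>)" for G c
    unfolding carrier_Mhat
  proof (intro conjI allI impI ballI)
    show "(\<lambda>z\<in>uhp. c \<cdot>\<^sub>v G z) \<in> uhp \<rightarrow>\<^sub>E carrier_vec N"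
      using val[OF G] by auto
    show "(\<lambda>z. vec_index ((\<lambda>z\<in>uhp. c \<cdot>\<^sub>v G z) z) i) holomorphic_on uhp" if "i < N" for i
      by (rule hol[of "\<lambda>z. c * vec_index (G z) i"], intro holomorphic_intros)
        (use G that carrier_vecD[OF val[OF G]] in \<open>auto simp: carrier_Mhat\<close>)
    show "(JJ \<gamma> z powi (- k)) \<cdot>\<^sub>v (\<lambda>z\<in>uhp. c \<cdot>\<^sub>v G z) (act \<gamma> z) = \<rho> \<gamma> *\<^sub>v (\<lambda>z\<in>uhp. c \<cdot>\<^sub>v G z) z"
      if "\<gamma> \<in> \<Gamma>" "z \<in> uhp" for \<gamma> z
      using that act[OF that] val[OF G] equiv[OF G that(2,1), symmetric]
      by (simp add: mult_mat_vec[OF rho] smult_smult_assoc mult.commute)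
  qed
  have zero: "(\<lambda>z\<in>uhp. 0\<^sub>v N) \<in> carrier (Mhat N k \<Gamma> \<rho>)"
    unfolding carrier_Mhat
  proof (intro conjI allI impI ballI)
    show "(\<lambda>z. vec_index ((\<lambda>z\<in>uhp. 0\<^sub>v N) z) i) holomorphic_on uhp" if "i < N" for i
      using that by (intro hol[OF holomorphic_on_const[of 0]]) auto
    show "(JJ \<gamma> z powi (- k)) \<cdot>\<^sub>v (\<lambda>z\<in>uhp. 0\<^sub>v N) (act \<gamma> z) = \<rho> \<gamma> *\<^sub>v (\<lambda>z\<in>uhp. 0\<^sub>v N) z"
      if "\<gamma> \<in> \<Gamma>" "z \<in> uhp" for \<gamma> z
      using that act[OF that] rho[OF that(1)] by (auto intro!: eq_vecI)
  qed auto
  show ?thesis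
    unfolding Mhat_def
    by (rule vectorspace_restrict_carrier[OF vectorspace_pointwise_module[OF vec_vs]])
      (use add smult zero in \<open>auto simp: Mhat_def pointwise_module_def module_vec_simps\<close>)
qed

section \<open>Linearity of the map and the isomorphism\<close>

lemma UU_add: "UU n (\<lambda>z\<in>uhp. F z + F' z) = (\<lambda>z\<in>uhp. UU n F z + UU n F' z)"
proof (rule ext)
  fix z
  show "UU n (\<lambda>z\<in>uhp. F z + F' z) z = (\<lambda>z\<in>uhp. UU n F z + UU n F' z) z"
  proof (cases "z \<in> uhp")
    case True
    note carr = UU_carrier[OF True]
    show ?thesis
      unfolding restrict_apply'[OF True] vec_eq_iff_atMost[OF carr add_carrier_vec[OF carr carr]]
      using carrier_vecD[OF carr] True
      by (simp add: UU_index distrib_left distrib_right sum.distrib)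
  qed (simp add: UU_def)
qed

lemma UU_smult: "UU n (\<lambda>z\<in>uhp. Polynomial.smult c (F z)) = (\<lambda>z\<in>uhp. c \<cdot>\<^sub>v UU n F z)"
proof (rule ext)
  fix z
  show "UU n (\<lambda>z\<in>uhp. Polynomial.smult c (F z)) z = (\<lambda>z\<in>uhp. c \<cdot>\<^sub>v UU n F z) z"
  proof (cases "z \<in> uhp")
    case True
    note carr = UU_carrier[OF True]
    show ?thesis
      unfolding restrict_apply'[OF True] vec_eq_iff_atMost[OF carr smult_carrier_vec[THEN iffD2, OF carr]]
      using carrier_vecD[OF carr] True
      by (simp add: UU_index sum_distrib_left mult_ac)
  qed (simp add: UU_def)
qed

theorem theorem1p4:
  fixes \<Gamma> :: "(real^2^2) set" and k :: int and n :: nat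
  assumes "discrete_subgroup_SL2R \<Gamma>"
    and "k > int n"
  shows "linear_map class_ring
           (QP n (k + int n) \<Gamma>)
           (Mhat (n + 1) k \<Gamma> (\<lambda>\<gamma>. map_mat complex_of_real (sym_rep n \<gamma>)))
           (UU n)
       \<and> bij_betw (UU n)
           (carrier (QP n (k + int n) \<Gamma>))
           (carrier (Mhat (n + 1) k \<Gamma> (\<lambda>\<gamma>. map_mat complex_of_real (sym_rep n \<gamma>))))"
    (is "linear_map _ ?Q ?M _ \<and> _")
proof -
  have det: "Determinants.det \<gamma> = 1" if "\<gamma> \<in> \<Gamma>" for \<gamma>
    using assms(1) that subgroup.subset[of \<Gamma> SL2R]
    by (auto simp: discrete_subgroup_SL2R_def SL2R_def)
  note act = act_in_uhp[OF _ det]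
  have maps: "UU n F \<in> carrier ?M" if F: "F \<in> carrier ?Q" for F
    unfolding carrier_Mhat
  proof (intro conjI allI impI ballI)
    show "UU n F \<in> uhp \<rightarrow>\<^sub>E carrier_vec (n + 1)"
      using UU_carrier by (auto simp: UU_def)
    show "(\<lambda>z. vec_index (UU n F z) i) holomorphic_on uhp" if "i < n + 1" for i
      using F that by (intro UU_holomorphic) (auto simp: carrier_QP)
    show "(JJ \<gamma> z powi (- k)) \<cdot>\<^sub>v UU n F (act \<gamma> z) =
        map_mat complex_of_real (sym_rep n \<gamma>) *\<^sub>v UU n F z" if "\<gamma> \<in> \<Gamma>" "z \<in> uhp" for \<gamma> z
      using F that act[of z \<gamma>] by (subst UU_equivariant_iff) (auto simp: carrier_QP det)
  qed
  have surj: "UU_inv n G \<in> carrier ?Q \<and> UU n (UU_inv n G) = G" if G: "G \<in> carrier ?M" for G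
  proof
    have val: "G z \<in> carrier_vec (n + 1)" if "z \<in> uhp" for z
      using G that by (auto simp: carrier_Mhat)
    show eq: "UU n (UU_inv n G) = G"
    proof
      fix z
      show "UU n (UU_inv n G) z = G z"
      proof (cases "z \<in> uhp")
        case True
        then show ?thesis by (intro UU_UU_inv val)
      next
        case False
        \<comment> \<open>Outside \<open>uhp\<close> both functions are \<open>undefined\<close>, so
          the equality holds for whole functions.\<close>
        then show ?thesis using G by (auto simp: UU_def carrier_Mhat PiE_def extensional_def)
      qed
    qed
    show "UU_inv n G \<in> carrier ?Q"
      unfolding carrier_QP
    proof (intro conjI allI impI ballI)
      show "UU_inv n G \<in> uhp \<rightarrow>\<^sub>E UNIV" by (simp add: UU_inv_def)
      show "degree (UU_inv n G z) \<le> n" if "z \<in> uhp" for z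
        by (rule degree_UU_inv[OF that])
      show "(\<lambda>z. coeff (UU_inv n G z) r) holomorphic_on uhp" if "r \<le> n" for r
        using G that by (intro UU_inv_holomorphic) (auto simp: carrier_Mhat)
      \<comment> \<open>Since \<open>UU\<close> sends \<open>UU_inv n G\<close> to \<open>G\<close>,
        the equivalence transfers the law of \<open>G\<close> to its preimage without a direct
        computation.\<close>
      show "Polynomial.smult (JJ \<gamma> z powi (- (k + int n)))
          (UU_inv n G (act \<gamma> z) \<circ>\<^sub>p Polynomial.smult ((JJ \<gamma> z)\<^sup>2) [:- KK \<gamma> z, 1:]) = UU_inv n G z"
        if "\<gamma> \<in> \<Gamma>" "z \<in> uhp" for \<gamma> z
        using G that act[of z \<gamma>]
        by (subst UU_equivariant_iff[symmetric]) (auto simp: eq carrier_Mhat det degree_UU_inv)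
    qed
  qed
  have "inj_on (UU n) (carrier ?Q)"
  proof (intro inj_onI ext)
    fix F F' z
    assume *: "F \<in> carrier ?Q" "F' \<in> carrier ?Q" "UU n F = UU n F'"
    show "F z = F' z"
    proof (cases "z \<in> uhp")
      case True
      with * show ?thesis by (intro UU_inj[OF True, of F n F']) (auto simp: carrier_QP)
    next
      case False
      with * show ?thesis by (auto simp: carrier_QP PiE_def extensional_def)
    qed
  qed
  moreover have "G \<in> UU n ` carrier ?Q" if "G \<in> carrier ?M" for G
    using surj[OF that] by (intro image_eqI[of _ _ "UU_inv n G"]) auto
  ultimately have bij: "bij_betw (UU n) (carrier ?Q) (carrier ?M)"
    using maps by (intro bij_betw_imageI subset_antisym subsetI) auto
  have "linear_map class_ring ?Q ?M (UU n)"
  proof (intro linear_map.intro mod_hom.intro mod_hom_axioms.intro)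
    show Q: "vectorspace class_ring ?Q"
      by (intro vectorspace_QP act)
    show M: "vectorspace class_ring ?M"
      using sym_rep_carrier by (intro vectorspace_Mhat act) auto
    show "module class_ring ?Q" "module class_ring ?M"
      using Q M by (simp_all add: vectorspace_def)
    show "UU n \<in> module_hom class_ring ?Q ?M"
      using maps
      by (auto simp: module_hom_def add_QP smult_QP add_Mhat smult_Mhat UU_add UU_smult)
  qed
  from this bij show ?thesis ..
qed

end
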